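(* Let $n,p,k$ be positive integers with $k\le p$ and $\delta\in(0,1)$. Assume that $\tilde\theta\le1$, where $$\tilde\theta:=2\sqrt{\frac{k^2\log(4p^2/\delta)}{n}}+2\,\frac{k\log(4p^2/\delta)}{n}+2\sqrt{\frac{\log(2p/\delta)}{n}}+2\,\frac{\log(2p/\delta)}{n}+4\sqrt{\frac{\log(1/\delta)}{n}}.$$ For $\theta>0$ define $$\tilde\tau_0=1+2\sqrt{\frac{k^2\log(4p^2/\delta)}{n}}+2\,\frac{k\log(4p^2/\delta)}{n}+2\sqrt{\frac{\log(2p/\delta)}{n}}+2\,\frac{\log(2p/\delta)}{n},$$ $$\tilde\tau_1=1+\theta-2(1+\theta)\sqrt{\frac{\log(1/\delta)}{n}}.$$ Then, for any $\theta>\tilde\theta$ and any $\tau\in[\tilde\tau_0,\tilde\tau_1]$, the test $\tilde\psi(\hat\Sigma)=\mathbf 1\{\mathsf{SDP}_k(\hat\Sigma)>\tau\}$ discriminates between $H_0$ and $H_1$ with probability $1-\delta$.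
   Context: Write $|v|_2$ for the Euclidean norm and $|v|_0$ for the number of nonzero entries of $v\in\mathbb R^p$, and let $\mathcal B_0(k)=\{v\in\mathbb R^p: |v|_2=1,\ |v|_0\le k\}$. One observes i.i.d. copies $X_1,\dots,X_n$ of a random vector $X\in\mathbb R^p$. The hypotheses are $H_0$: $X\sim\mathcal N(0,I_p)$; and $H_1$: $X\sim\mathcal N(0,I_p+\theta vv^\top)$ for some $v\in\mathcal B_0(k)$, where $\theta>0$. The empirical covariance matrix is $\hat\Sigma=\frac1n\sum_{i=1}^nX_iX_i^\top$. For a symmetric $p\times p$ matrix $A$, $$\mathsf{SDP}_k(A)=\max\{\mathrm{Tr}(AZ): Z \text{ symmetric } p\times p,\ Z\succeq0,\ \mathrm{Tr}(Z)=1,\ |Z|_1\le k\},$$ where $|Z|_1=\sum_{i,j}|Z_{ij}|$. A test $\psi$ (with values in $\{0,1\}$) discriminates between $H_0$ and $H_1$ with probability $1-\delta$ if its type I error (probability that $\psi=1$ under $H_0$) and its type II error (probability that $\psi=0$ under $H_1$, for every $v\in\mathcal B_0(k)$) are both at most $\delta$. *)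

theory Defs
  imports "HOL-Probability.Probability"
begin

section \<open>Sparse directions and matrices\<close>

definition l0_norm :: "real ^ 'p \<Rightarrow> nat" where
  "l0_norm v = card {i. v $ i \<noteq> 0}"

definition sparse_sphere :: "nat \<Rightarrow> (real ^ 'p) set" where
  "sparse_sphere k = {v. norm v = 1 \<and> l0_norm v \<le> k}"

definition outer :: "real ^ 'p \<Rightarrow> real ^ 'p \<Rightarrow> real ^ 'p ^ 'p" where
  "outer u v = (\<chi> i j. u $ i * v $ j)"

definition psd :: "real ^ 'p ^ 'p \<Rightarrow> bool" where
  "psd A \<longleftrightarrow> transpose A = A \<and> (\<forall>x. 0 \<le> x \<bullet> (A *v x))"

definition l1_norm :: "real ^ 'p ^ 'p \<Rightarrow> real" where
  "l1_norm A = (\<Sum>i\<in>UNIV. \<Sum>j\<in>UNIV. \<bar>A $ i $ j\<bar>)"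

definition sdp_feasible :: "nat \<Rightarrow> (real ^ 'p ^ 'p) set" where
  "sdp_feasible k = {Z. psd Z \<and> trace Z = 1 \<and> l1_norm Z \<le> real k}"

text \<open>For \<open>k \<ge> 1\<close> the feasible set is nonempty and compact, so the supremum is a maximum.\<close>

definition SDP :: "nat \<Rightarrow> real ^ 'p ^ 'p \<Rightarrow> real" where
  "SDP k A = (SUP Z \<in> sdp_feasible k. trace (A ** Z))"

section \<open>Gaussian samples\<close>

text \<open>\<open>normal_density 0 0\<close> is not a probability density, so variance zero is treated separately
  as a point mass.\<close>

definition centred_normal :: "real \<Rightarrow> real measure" where
  "centred_normal s = (if s = 0 then return borel 0 else density lborel (normal_density 0 (sqrt s)))"

text \<open>\<open>X \<sim> N(0, S)\<close> in the sense of Gaussian vectors: every linear form \<open>u \<bullet> X\<close> is a univariate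
  normal variable, with mean \<open>0\<close> and variance \<open>u \<bullet> S u\<close>. The covariance \<open>S\<close> may be singular.\<close>

definition gaussian_vector :: "'w measure \<Rightarrow> ('w \<Rightarrow> real ^ 'p) \<Rightarrow> real ^ 'p ^ 'p \<Rightarrow> bool" where
  "gaussian_vector M X S \<longleftrightarrow>
     X \<in> borel_measurable M \<and> psd S \<and>
     (\<forall>u. distr M borel (\<lambda>w. u \<bullet> X w) = centred_normal (u \<bullet> (S *v u)))"

definition iid_gaussian ::
  "'w measure \<Rightarrow> (nat \<Rightarrow> 'w \<Rightarrow> real ^ 'p) \<Rightarrow> nat \<Rightarrow> real ^ 'p ^ 'p \<Rightarrow> bool" where
  "iid_gaussian M X n S \<longleftrightarrow>
     prob_space M \<and>
     prob_space.indep_vars M (\<lambda>_. borel) X {1..n} \<and>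
     (\<forall>i\<in>{1..n}. gaussian_vector M (X i) S)"

definition empirical_cov :: "nat \<Rightarrow> (nat \<Rightarrow> real ^ 'p) \<Rightarrow> real ^ 'p ^ 'p" where
  "empirical_cov n x = (1 / real n) *\<^sub>R (\<Sum>i=1..n. outer (x i) (x i))"

section \<open>Tests\<close>

text \<open>A test is a measurable function of the empirical covariance matrix, with values in \<open>{0, 1}\<close>.
  The errors are bounded over every sample with the prescribed law, on every probability space
  whose points are of type \<open>'w\<close>.\<close>

definition discriminates ::
  "'w itself \<Rightarrow> nat \<Rightarrow> nat \<Rightarrow> real \<Rightarrow> real \<Rightarrow> (real ^ 'p ^ 'p \<Rightarrow> nat) \<Rightarrow> bool" where
  "discriminates (_ :: 'w itself) n k \<theta> \<delta> \<psi> \<longleftrightarrow>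
     \<psi> \<in> measurable borel (count_space {0, 1}) \<and>
     (\<forall>(M :: 'w measure) X. iid_gaussian M X n (mat 1) \<longrightarrow>
        \<P>(w in M. \<psi> (empirical_cov n (\<lambda>i. X i w)) = 1) \<le> \<delta>) \<and>
     (\<forall>v \<in> sparse_sphere k. \<forall>(M :: 'w measure) X.
        iid_gaussian M X n (mat 1 + \<theta> *\<^sub>R outer v v) \<longrightarrow>
        \<P>(w in M. \<psi> (empirical_cov n (\<lambda>i. X i w)) = 0) \<le> \<delta>)"

definition sdp_test :: "nat \<Rightarrow> real \<Rightarrow> real ^ 'p ^ 'p \<Rightarrow> nat" where
  "sdp_test k \<tau> A = (if SDP k A > \<tau> then 1 else 0)"

section \<open>Detection levels\<close>

definition theta_tilde :: "nat \<Rightarrow> nat \<Rightarrow> nat \<Rightarrow> real \<Rightarrow> real" where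
  "theta_tilde n p k \<delta> =
     2 * sqrt ((real k)\<^sup>2 * ln (4 * (real p)\<^sup>2 / \<delta>) / real n)
     + 2 * (real k * ln (4 * (real p)\<^sup>2 / \<delta>) / real n)
     + 2 * sqrt (ln (2 * real p / \<delta>) / real n)
     + 2 * (ln (2 * real p / \<delta>) / real n)
     + 4 * sqrt (ln (1 / \<delta>) / real n)"

definition tau0_tilde :: "nat \<Rightarrow> nat \<Rightarrow> nat \<Rightarrow> real \<Rightarrow> real" where
  "tau0_tilde n p k \<delta> =
     1 + 2 * sqrt ((real k)\<^sup>2 * ln (4 * (real p)\<^sup>2 / \<delta>) / real n)
     + 2 * (real k * ln (4 * (real p)\<^sup>2 / \<delta>) / real n)
     + 2 * sqrt (ln (2 * real p / \<delta>) / real n)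
     + 2 * (ln (2 * real p / \<delta>) / real n)"

definition tau1_tilde :: "nat \<Rightarrow> real \<Rightarrow> real \<Rightarrow> real" where
  "tau1_tilde n \<delta> \<theta> = 1 + \<theta> - 2 * (1 + \<theta>) * sqrt (ln (1 / \<delta>) / real n)"

end

theory Submission
  imports Defs
begin

text \<open>Under \<open>H\<^sub>1\<close> the matrix \<open>v v\<^sup>T\<close> is feasible, so \<open>SDP\<close> dominates the empirical variance in
  direction \<open>v\<close>, a rescaled chi-square variable. Under \<open>H\<^sub>0\<close> weak duality bounds \<open>SDP\<close> by the
  largest diagonal entry plus \<open>k\<close> times the largest off-diagonal entry of the empirical covariance;
  by polarization an off-diagonal entry is half the difference of two chi-square variables, so only
  \<open>p\<close> one-sided and at most \<open>p\<^sup>2\<close> two-sided chi-square deviations have to be controlled.\<close>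

section \<open>Chi-square tails\<close>

text \<open>The difference of the sides vanishes at 0 and has derivative
  \<open>y\<^sup>2 / (1 + y)\<close>. Taken at \<open>2 * a\<close>, it yields the exponent of the
  lower chi-square tail.\<close>

lemma ln_add_one_ge_quadratic:
  fixes x :: real
  assumes "0 \<le> x"
  shows "x - x\<^sup>2 / 2 \<le> ln (1 + x)"
proof -
  define f where "f y = ln (1 + y) - y + y\<^sup>2 / 2" for y :: real
  have "f 0 \<le> f x"
  proof (rule DERIV_nonneg_imp_nondecreasing[OF assms])
    fix y :: real
    assume y: "0 \<le> y"
    have "(f has_real_derivative (1 / (1 + y) - 1 + y)) (at y)"
      unfolding f_def using y by (auto intro!: derivative_eq_intros)
    moreover have "1 / (1 + y) - 1 + y = y\<^sup>2 / (1 + y)"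
      using y by (simp add: field_simps power2_eq_square)
    ultimately show "\<exists>d. (f has_real_derivative d) (at y) \<and> 0 \<le> d"
      using y by (intro exI[of _ "y\<^sup>2 / (1 + y)"]) simp
  qed
  then show ?thesis by (simp add: f_def)
qed

text \<open>The difference of the sides vanishes at 1 and its derivative is half a square. The upper
  tail uses it at \<open>1 + 2 * a\<close>, where the simpler bound \<open>t - 1\<close> would be
  too large.\<close>

lemma ln_le_half_diff_inverse:
  fixes t :: real
  assumes "1 \<le> t"
  shows "ln t \<le> (t - 1 / t) / 2"
proof -
  define f where "f y = (y - 1 / y) / 2 - ln y" for y :: real
  have "f 1 \<le> f t"
  proof (rule DERIV_nonneg_imp_nondecreasing[OF assms])
    fix y :: real
    assume y: "1 \<le> y"
    have "(f has_real_derivative ((1 + 1 / y\<^sup>2) / 2 - 1 / y)) (at y)"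
      unfolding f_def using y
      by (auto intro!: derivative_eq_intros simp: power2_eq_square)
    moreover have "(1 + 1 / y\<^sup>2) / 2 - 1 / y = (1 - 1 / y)\<^sup>2 / 2"
      using y by (simp add: field_simps power2_eq_square)
    ultimately show "\<exists>d. (f has_real_derivative d) (at y) \<and> 0 \<le> d"
      by (intro exI[of _ "(1 - 1 / y)\<^sup>2 / 2"]) simp
  qed
  then show ?thesis by (simp add: f_def)
qed

text \<open>The factor \<open>exp (l * x\<^sup>2)\<close> turns the density of variance
  \<open>s\<close> into a multiple of the density of variance \<open>s / (1 - 2 * l * s)\<close>,
  whose mass is 1. The sign of \<open>l\<close> is free.\<close>

lemma nn_integral_centred_normal_exp_square:
  fixes s l :: real
  assumes s: "0 < s" and l: "2 * l * s < 1"
  shows "(\<integral>\<^sup>+x. ennreal (exp (l * x\<^sup>2)) \<partial>centred_normal s) = ennreal (1 / sqrt (1 - 2 * l * s))"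
proof -
  define r where "r = 1 - 2 * l * s"
  have r: "0 < r" using l by (simp add: r_def)
  have eq: "normal_density 0 (sqrt s) x * exp (l * x\<^sup>2) =
      1 / sqrt r * normal_density 0 (sqrt (s / r)) x" for x
  proof -
    have e: "- x\<^sup>2 / (2 * s) + l * x\<^sup>2 = - x\<^sup>2 / (2 * (s / r))"
      using s r unfolding r_def by (simp add: field_simps)
    have "normal_density 0 (sqrt s) x * exp (l * x\<^sup>2)
        = 1 / sqrt (2 * pi * s) * exp (- x\<^sup>2 / (2 * s) + l * x\<^sup>2)"
      using s by (simp add: normal_density_def mult_exp_exp)
    also have "1 / sqrt (2 * pi * s) = 1 / sqrt r * (1 / sqrt (2 * pi * (s / r)))"
      using s r by (simp add: real_sqrt_divide real_sqrt_mult)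
    finally show ?thesis
      using s r unfolding e by (simp add: normal_density_def)
  qed
  have "(\<integral>\<^sup>+x. ennreal (exp (l * x\<^sup>2)) \<partial>centred_normal s)
      = (\<integral>\<^sup>+x. ennreal (normal_density 0 (sqrt s) x) * ennreal (exp (l * x\<^sup>2)) \<partial>lborel)"
    using s by (simp add: centred_normal_def nn_integral_density)
  also have "\<dots> = (\<integral>\<^sup>+x. ennreal (1 / sqrt r) * ennreal (normal_density 0 (sqrt (s / r)) x) \<partial>lborel)"
    using r by (intro nn_integral_cong) (simp add: ennreal_mult'[symmetric] eq del: times_divide_eq_left)
  also have "\<dots> = ennreal (1 / sqrt r) * (\<integral>\<^sup>+x. ennreal (normal_density 0 (sqrt (s / r)) x) \<partial>lborel)"
    by (rule nn_integral_cmult) simp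
  also have "(\<integral>\<^sup>+x. ennreal (normal_density 0 (sqrt (s / r)) x) \<partial>lborel) = 1"
    using s r by (simp add: nn_integral_eq_integral)
  finally show ?thesis by (simp add: r_def)
qed

context prob_space
begin

text \<open>Markov's inequality for the exponential, which factorizes over \<open>I\<close> by
  independence. Keeping \<open>l\<close> on both sides of the event lets one bound serve both tails:
  \<open>l > 0\<close> for the upper one, \<open>l < 0\<close> for the lower one.\<close>

lemma chernoff_sum_squares:
  fixes Y :: "'i \<Rightarrow> 'a \<Rightarrow> real" and s l b :: real
  assumes fin: "finite I" and indep: "indep_vars (\<lambda>_. borel) Y I"
    and Y: "\<And>i. i \<in> I \<Longrightarrow> distr M borel (Y i) = centred_normal s"
    and s: "0 < s" and l: "2 * l * s < 1"
  shows "\<P>(w in M. l * b \<le> l * (\<Sum>i\<in>I. (Y i w)\<^sup>2))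
    \<le> exp (- l * b - real (card I) / 2 * ln (1 - 2 * l * s))"
proof -
  have [measurable]: "Y i \<in> borel_measurable M" if "i \<in> I" for i
    using indep that by (auto simp: indep_vars_def)
  have mgf: "(\<integral>\<^sup>+w. ennreal (exp (l * (Y i w)\<^sup>2)) \<partial>M) = ennreal (1 / sqrt (1 - 2 * l * s))"
    if i: "i \<in> I" for i
    using i s l by (subst nn_integral_centred_normal_exp_square[symmetric])
      (simp_all add: Y[symmetric] nn_integral_distr)
  have "emeasure M {w \<in> space M. 1 \<le> ennreal (exp (- l * b)) * ennreal (exp (l * (\<Sum>i\<in>I. (Y i w)\<^sup>2)))}
    \<le> ennreal (exp (- l * b)) *
      (\<integral>\<^sup>+w. ennreal (exp (l * (\<Sum>i\<in>I. (Y i w)\<^sup>2))) * indicator (space M) w \<partial>M)"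
    by (rule nn_integral_Markov_inequality) measurable
  also have "{w \<in> space M. 1 \<le> ennreal (exp (- l * b)) * ennreal (exp (l * (\<Sum>i\<in>I. (Y i w)\<^sup>2)))}
    = {w \<in> space M. l * b \<le> l * (\<Sum>i\<in>I. (Y i w)\<^sup>2)}"
    by (simp add: ennreal_mult[symmetric] exp_add[symmetric])
  also have "(\<integral>\<^sup>+w. ennreal (exp (l * (\<Sum>i\<in>I. (Y i w)\<^sup>2))) * indicator (space M) w \<partial>M)
    = (\<integral>\<^sup>+w. (\<Prod>i\<in>I. ennreal (exp (l * (Y i w)\<^sup>2))) \<partial>M)"
    by (intro nn_integral_cong) (simp add: sum_distrib_left exp_sum fin prod_ennreal)
  also have "\<dots> = (\<Prod>i\<in>I. \<integral>\<^sup>+w. ennreal (exp (l * (Y i w)\<^sup>2)) \<partial>M)"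
    by (intro indep_vars_nn_integral fin indep_vars_compose2[OF indep]) auto
  also have "\<dots> = ennreal ((1 / sqrt (1 - 2 * l * s)) ^ card I)"
    using l by (simp add: mgf ennreal_power)
  also have "1 / sqrt (1 - 2 * l * s) = exp (- ln (1 - 2 * l * s) / 2)"
    using l by (simp add: exp_minus powr_half_sqrt[symmetric] powr_def field_simps)
  also have "exp (- ln (1 - 2 * l * s) / 2) ^ card I = exp (- real (card I) / 2 * ln (1 - 2 * l * s))"
    by (simp add: exp_of_nat_mult[symmetric])
  also have "ennreal (exp (- l * b)) * ennreal (exp (- real (card I) / 2 * ln (1 - 2 * l * s)))
    = ennreal (exp (- l * b - real (card I) / 2 * ln (1 - 2 * l * s)))"
    by (simp add: ennreal_mult[symmetric] exp_add[symmetric])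
  finally show ?thesis
    by (simp add: emeasure_eq_measure)
qed

text \<open>The Laurent-Massart bound for \<open>s\<close> times a chi-square variable, with its
  parameter \<open>x\<close> written as \<open>card I * a\<^sup>2\<close>.\<close>

lemma chi_square_upper_tail:
  fixes Y :: "'i \<Rightarrow> 'a \<Rightarrow> real" and s a :: real
  assumes fin: "finite I" and indep: "indep_vars (\<lambda>_. borel) Y I"
    and Y: "\<And>i. i \<in> I \<Longrightarrow> distr M borel (Y i) = centred_normal s"
    and s: "0 < s" and a: "0 < a"
  shows "\<P>(w in M. real (card I) * s * (1 + 2 * a + 2 * a\<^sup>2) \<le> (\<Sum>i\<in>I. (Y i w)\<^sup>2))
    \<le> exp (- real (card I) * a\<^sup>2)"
proof -
  \<comment> \<open>This \<open>l\<close> would be optimal for a threshold without the term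
    \<open>2 * a\<^sup>2\<close>. It gives \<open>1 - 2 * l * s = 1 / (1 + 2 * a)\<close>, a form to
    which \<open>ln_le_half_diff_inverse\<close> applies.\<close>
  define l where "l = a / ((1 + 2 * a) * s)"
  have l: "0 < l" using a s by (simp add: l_def)
  have l_s: "l * s = a / (1 + 2 * a)"
    using s by (simp add: l_def)
  then have ls: "1 - 2 * l * s = 1 / (1 + 2 * a)"
    using a by (simp add: field_simps)
  have "0 < 1 / (1 + 2 * a)" using a by simp
  then have ls1: "2 * l * s < 1" using ls by linarith
  let ?n = "real (card I)" and ?b = "real (card I) * s * (1 + 2 * a + 2 * a\<^sup>2)"
  have "\<P>(w in M. ?b \<le> (\<Sum>i\<in>I. (Y i w)\<^sup>2)) = \<P>(w in M. l * ?b \<le> l * (\<Sum>i\<in>I. (Y i w)\<^sup>2))"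
    using l by (simp add: mult.assoc)
  also have "\<dots> \<le> exp (- l * ?b - ?n / 2 * ln (1 - 2 * l * s))"
    by (rule chernoff_sum_squares[OF fin indep Y s ls1])
  also have "- l * ?b - ?n / 2 * ln (1 - 2 * l * s)
      = ?n * (- (a * (1 + 2 * a + 2 * a\<^sup>2)) / (1 + 2 * a) + ln (1 + 2 * a) / 2)"
  proof -
    have "l * ?b = ?n * (l * s * (1 + 2 * a + 2 * a\<^sup>2))" by simp
    also have "\<dots> = ?n * (a * (1 + 2 * a + 2 * a\<^sup>2) / (1 + 2 * a))" unfolding l_s by simp
    finally have "- l * ?b = ?n * (- (a * (1 + 2 * a + 2 * a\<^sup>2)) / (1 + 2 * a))" by simp
    moreover have "ln (1 - 2 * l * s) = - ln (1 + 2 * a)" unfolding ls using a by (simp add: ln_div)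
    ultimately show ?thesis by (simp add: distrib_left)
  qed
  also have "\<dots> \<le> ?n * (- a\<^sup>2)"
  proof (intro mult_left_mono)
    have "ln (1 + 2 * a) \<le> (1 + 2 * a - 1 / (1 + 2 * a)) / 2"
      using a by (intro ln_le_half_diff_inverse) simp
    moreover have "(1 + 2 * a - 1 / (1 + 2 * a)) / 2 / 2
        = - a\<^sup>2 + (a * (1 + 2 * a + 2 * a\<^sup>2)) / (1 + 2 * a)"
      using a by (simp add: divide_simps power2_eq_square) algebra
    ultimately show "- (a * (1 + 2 * a + 2 * a\<^sup>2)) / (1 + 2 * a) + ln (1 + 2 * a) / 2 \<le> - a\<^sup>2"
      by simp
  qed simp
  finally show ?thesis by simp
qed

lemma chi_square_lower_tail:
  fixes Y :: "'i \<Rightarrow> 'a \<Rightarrow> real" and s a :: real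
  assumes fin: "finite I" and indep: "indep_vars (\<lambda>_. borel) Y I"
    and Y: "\<And>i. i \<in> I \<Longrightarrow> distr M borel (Y i) = centred_normal s"
    and s: "0 < s" and a: "0 < a"
  shows "\<P>(w in M. (\<Sum>i\<in>I. (Y i w)\<^sup>2) \<le> real (card I) * s * (1 - 2 * a))
    \<le> exp (- real (card I) * a\<^sup>2)"
proof -
  \<comment> \<open>Here \<open>1 - 2 * l * s = 1 + 2 * a\<close>, which agrees with the optimal
    \<open>1 / (1 - 2 * a)\<close> to first order and stays admissible for every
    \<open>a > 0\<close>, even when the threshold is negative.\<close>
  define l where "l = - a / s"
  have l: "l < 0" using a s by (simp add: l_def)
  have ls: "1 - 2 * l * s = 1 + 2 * a"
    using s by (simp add: l_def)
  then have ls1: "2 * l * s < 1" using a by linarith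
  let ?n = "real (card I)" and ?b = "real (card I) * s * (1 - 2 * a)"
  have "\<P>(w in M. (\<Sum>i\<in>I. (Y i w)\<^sup>2) \<le> ?b) = \<P>(w in M. l * ?b \<le> l * (\<Sum>i\<in>I. (Y i w)\<^sup>2))"
    using l by (simp add: mult.assoc)
  also have "\<dots> \<le> exp (- l * ?b - ?n / 2 * ln (1 - 2 * l * s))"
    by (rule chernoff_sum_squares[OF fin indep Y s ls1])
  also have "- l * ?b - ?n / 2 * ln (1 - 2 * l * s) = ?n * (a * (1 - 2 * a) - ln (1 + 2 * a) / 2)"
    unfolding ls using s by (simp add: l_def field_simps)
  also have "\<dots> \<le> ?n * (- a\<^sup>2)"
    using ln_add_one_ge_quadratic[of "2 * a"] a
    by (intro mult_left_mono) (simp_all add: power2_eq_square algebra_simps)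
  finally show ?thesis by simp
qed

end

section \<open>The empirical covariance and the semidefinite program\<close>

lemma empirical_cov_nth:
  "empirical_cov n x $ i $ j = (\<Sum>m=1..n. x m $ i * x m $ j) / real n"
  by (simp add: empirical_cov_def outer_def)

lemma outer_mult_vector: "outer u v *v x = (v \<bullet> x) *\<^sub>R u"
  by (simp add: vec_eq_iff outer_def matrix_vector_mult_def inner_vec_def sum_distrib_left
      sum_distrib_right mult_ac)

lemma psd_outer: "psd (outer v v)"
  by (simp add: psd_def outer_mult_vector inner_commute)
    (simp add: transpose_def outer_def vec_eq_iff mult.commute)

lemma trace_matrix_mult: "trace (A ** Z) = (\<Sum>i\<in>UNIV. \<Sum>j\<in>UNIV. A $ i $ j * Z $ j $ i)"
  by (simp add: trace_def matrix_matrix_mult_def)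

lemma trace_empirical_cov_outer:
  "trace (empirical_cov n x ** outer v v) = (\<Sum>m=1..n. (v \<bullet> x m)\<^sup>2) / real n"
proof -
  have "(v \<bullet> x m)\<^sup>2 = (\<Sum>i\<in>UNIV. \<Sum>j\<in>UNIV. x m $ i * x m $ j * (v $ j * v $ i))" for m
    by (simp add: inner_vec_def power2_eq_square sum_product mult_ac)
  then have "(\<Sum>m=1..n. (v \<bullet> x m)\<^sup>2) =
      (\<Sum>i\<in>UNIV. \<Sum>j\<in>UNIV. \<Sum>m=1..n. x m $ i * x m $ j * (v $ j * v $ i))"
    \<comment> \<open>Instantiating both index sets fixes the direction of the swap, so rewriting
      moves the sample index innermost and stops.\<close>
    by (simp only: sum.swap[where A = "{1..n}" and B = UNIV])
  then show ?thesis
    by (simp add: trace_matrix_mult empirical_cov_nth outer_def sum_divide_distrib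
        sum_distrib_right sum_distrib_left)
qed

text \<open>Hoelder duality between the entrywise maximum norm and the entrywise l1 norm.\<close>

lemma trace_le_l1_norm:
  fixes A Z :: "real ^ 'p ^ 'p"
  assumes "\<And>i j. \<bar>A $ i $ j\<bar> \<le> b"
  shows "trace (A ** Z) \<le> b * l1_norm Z"
proof -
  have "trace (A ** Z) \<le> (\<Sum>i\<in>UNIV. \<Sum>j\<in>UNIV. b * \<bar>Z $ j $ i\<bar>)"
    unfolding trace_matrix_mult
  proof (intro sum_mono)
    fix i j
    have "A $ i $ j * Z $ j $ i \<le> \<bar>A $ i $ j\<bar> * \<bar>Z $ j $ i\<bar>"
      by (metis abs_ge_self abs_mult)
    also have "\<dots> \<le> b * \<bar>Z $ j $ i\<bar>"
      using assms by (intro mult_right_mono) auto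
    finally show "A $ i $ j * Z $ j $ i \<le> b * \<bar>Z $ j $ i\<bar>" .
  qed
  also have "\<dots> = b * l1_norm Z"
    unfolding l1_norm_def sum_distrib_left[symmetric] by (subst sum.swap) simp
  finally show ?thesis .
qed

text \<open>A real \<open>SUP\<close> is informative only for a set bounded above. The constraint on
  \<open>l1_norm Z\<close> supplies this through a crude common bound for the entries of
  \<open>A\<close>.\<close>

lemma bdd_above_sdp: "bdd_above ((\<lambda>Z. trace (A ** Z)) ` sdp_feasible k)"
proof (rule bdd_aboveI2)
  fix Z :: "real ^ 'a ^ 'a"
  assume Z: "Z \<in> sdp_feasible k"
  define b where "b = (\<Sum>i\<in>UNIV. \<Sum>j\<in>UNIV. \<bar>A $ i $ j\<bar>)"
  have b: "\<bar>A $ i $ j\<bar> \<le> b" for i j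
  proof -
    have "\<bar>A $ i $ j\<bar> \<le> (\<Sum>j\<in>UNIV. \<bar>A $ i $ j\<bar>)"
      by (rule member_le_sum) auto
    also have "\<dots> \<le> b"
      unfolding b_def by (rule member_le_sum) (auto intro: sum_nonneg)
    finally show ?thesis .
  qed
  then have "trace (A ** Z) \<le> b * l1_norm Z"
    by (rule trace_le_l1_norm)
  \<comment> \<open>The instance of \<open>b\<close> at an arbitrary index provides
    \<open>0 \<le> b\<close>.\<close>
  also have "\<dots> \<le> b * real k"
    using Z b[of undefined undefined] by (intro mult_left_mono) (auto simp: sdp_feasible_def)
  finally show "trace (A ** Z) \<le> b * real k" .
qed

lemma SDP_upper: "Z \<in> sdp_feasible k \<Longrightarrow> trace (A ** Z) \<le> SDP k A"
  unfolding SDP_def by (rule cSUP_upper[OF _ bdd_above_sdp])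

text \<open>The left side is the squared l1 norm of \<open>v\<close>. Cauchy-Schwarz against the
  constant 1 on the support of \<open>v\<close> bounds it by \<open>l0_norm v\<close> times the
  squared Euclidean norm.\<close>

lemma l1_norm_outer_le:
  assumes v: "v \<in> sparse_sphere k"
  shows "l1_norm (outer v v) \<le> real k"
proof -
  have "l1_norm (outer v v) = (\<Sum>i\<in>UNIV. \<bar>v $ i\<bar>)\<^sup>2"
    by (simp add: l1_norm_def outer_def abs_mult power2_eq_square sum_product)
  also have "(\<Sum>i\<in>UNIV. \<bar>v $ i\<bar>) = (\<Sum>i\<in>{i. v $ i \<noteq> 0}. \<bar>v $ i\<bar>)"
    by (intro sum.mono_neutral_right) auto
  also have "(\<Sum>i\<in>{i. v $ i \<noteq> 0}. \<bar>v $ i\<bar>)\<^sup>2 \<le> real (l0_norm v) * (\<Sum>i\<in>{i. v $ i \<noteq> 0}. \<bar>v $ i\<bar>\<^sup>2)"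
    using Cauchy_Schwarz_ineq_sum[of "\<lambda>_. 1" "\<lambda>i. \<bar>v $ i\<bar>" "{i. v $ i \<noteq> 0}"]
    by (simp add: l0_norm_def)
  also have "(\<Sum>i\<in>{i. v $ i \<noteq> 0}. \<bar>v $ i\<bar>\<^sup>2) = (\<Sum>i\<in>UNIV. (v $ i)\<^sup>2)"
    by (intro sum.mono_neutral_cong_left) auto
  also have "\<dots> = v \<bullet> v"
    by (simp add: inner_vec_def power2_eq_square)
  also have "\<dots> = 1"
    using v by (simp add: sparse_sphere_def dot_square_norm)
  finally show ?thesis
    using v by (simp add: sparse_sphere_def)
qed

lemma outer_feasible:
  assumes v: "v \<in> sparse_sphere k"
  shows "outer v v \<in> sdp_feasible k"
proof -
  have "trace (outer v v) = v \<bullet> v"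
    by (simp add: trace_def outer_def inner_vec_def)
  then show ?thesis
    using v l1_norm_outer_le[OF v] psd_outer
    by (simp add: sdp_feasible_def sparse_sphere_def dot_square_norm)
qed

lemma axis_sparse_sphere: "1 \<le> k \<Longrightarrow> axis i 1 \<in> sparse_sphere k"
proof -
  have "{j. axis i (1 :: real) $ j \<noteq> 0} = {i}" by (auto simp: axis_def)
  then show "1 \<le> k \<Longrightarrow> axis i 1 \<in> sparse_sphere k"
    by (simp add: sparse_sphere_def l0_norm_def)
qed

text \<open>Required for bounding a real supremum from above and for comparing it with
  \<open><\<close>. Any coordinate vector yields a feasible rank-one matrix.\<close>

lemma sdp_feasible_nonempty: "1 \<le> k \<Longrightarrow> sdp_feasible k \<noteq> {}"
  using outer_feasible[OF axis_sparse_sphere] by blast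

lemma psd_diag_nonneg:
  assumes "psd Z"
  shows "0 \<le> Z $ i $ i"
proof -
  have "0 \<le> axis i 1 \<bullet> (Z *v axis i 1)" using assms by (simp add: psd_def)
  then show ?thesis by (simp add: inner_axis' matrix_vector_mul_component inner_axis)
qed

text \<open>Weak duality, with the off-diagonal part of \<open>A\<close> as the dual variable.\<close>

lemma SDP_le_diag_offdiag:
  fixes A :: "real ^ 'p ^ 'p"
  assumes k: "1 \<le> k" and D: "\<And>i. A $ i $ i \<le> d"
    and O: "\<And>i j. i \<noteq> j \<Longrightarrow> \<bar>A $ i $ j\<bar> \<le> c" and c: "0 \<le> c"
  shows "SDP k A \<le> d + real k * c"
  unfolding SDP_def
proof (rule cSUP_least[OF sdp_feasible_nonempty[OF k]])
  fix Z :: "real ^ 'p ^ 'p"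
  assume Z: "Z \<in> sdp_feasible k"
  let ?D = "\<chi> i j. if i = j then A $ i $ j else 0" and ?O = "\<chi> i j. if i = j then 0 else A $ i $ j"
  have "trace (A ** Z) = trace ((?D + ?O) ** Z)"
    by (rule arg_cong[of _ _ "\<lambda>B. trace (B ** Z)"]) (simp add: vec_eq_iff)
  also have "\<dots> = trace (?D ** Z) + trace (?O ** Z)"
    by (simp only: trace_matrix_mult vector_add_component distrib_right sum.distrib)
  \<comment> \<open>Since \<open>Z\<close> has a nonnegative diagonal of sum 1, this trace is a
    weighted mean of the diagonal entries of \<open>A\<close>; upper bounds on them suffice.\<close>
  also have "trace (?D ** Z) \<le> d"
  proof -
    have "trace (?D ** Z) = (\<Sum>i\<in>UNIV. A $ i $ i * Z $ i $ i)"
      by (simp add: trace_matrix_mult if_distrib[of "\<lambda>x. x * _"] cong: if_cong)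
    also have "\<dots> \<le> (\<Sum>i\<in>UNIV. d * Z $ i $ i)"
      using Z by (intro sum_mono mult_right_mono D psd_diag_nonneg) (simp add: sdp_feasible_def)
    also have "\<dots> = d"
      using Z by (simp add: sum_distrib_left[symmetric] sdp_feasible_def trace_def)
    finally show ?thesis .
  qed
  also have "trace (?O ** Z) \<le> real k * c"
  proof -
    have "trace (?O ** Z) \<le> c * l1_norm Z"
      by (rule trace_le_l1_norm) (use O c in auto)
    also have "\<dots> \<le> c * real k"
      using Z c by (intro mult_left_mono) (auto simp: sdp_feasible_def)
    finally show ?thesis by (simp add: mult.commute)
  qed
  finally show "trace (A ** Z) \<le> d + real k * c" by simp
qed

text \<open>A supremum of continuous functions is lower semicontinuous.\<close>

lemma borel_measurable_SDP:
  assumes k: "1 \<le> k"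
  shows "SDP k \<in> borel_measurable borel"
proof (rule borel_measurableI_greater)
  fix y
  have "{A. y < SDP k A} = (\<Union>Z\<in>sdp_feasible k. {A. y < trace (A ** Z)})"
    unfolding SDP_def by (auto simp: less_cSUP_iff[OF sdp_feasible_nonempty[OF k] bdd_above_sdp])
  also have "\<dots> \<in> sets borel"
    unfolding trace_matrix_mult
    by (intro borel_open open_UN ballI open_Collect_less continuous_intros)
  finally show "{A \<in> space borel. y < SDP k A} \<in> sets borel" by simp
qed

lemma sdp_test_measurable:
  assumes "1 \<le> k"
  shows "sdp_test k \<tau> \<in> measurable borel (count_space {0, 1})"
proof -
  note [measurable] = borel_measurable_SDP[OF assms]
  show ?thesis unfolding sdp_test_def by measurable
qed

section \<open>Directional variances of a Gaussian sample\<close>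

lemma iid_gaussian_direction:
  assumes G: "iid_gaussian M X n S"
  shows "prob_space.indep_vars M (\<lambda>_. borel) (\<lambda>m w. u \<bullet> X m w) {1..n}"
    and "m \<in> {1..n} \<Longrightarrow> distr M borel (\<lambda>w. u \<bullet> X m w) = centred_normal (u \<bullet> (S *v u))"
    and "m \<in> {1..n} \<Longrightarrow> X m \<in> borel_measurable M"
proof -
  interpret prob_space M using G by (simp add: iid_gaussian_def)
  show "indep_vars (\<lambda>_. borel) (\<lambda>m w. u \<bullet> X m w) {1..n}"
    using G by (intro indep_vars_compose2[where Y = "\<lambda>_ x. u \<bullet> x" and M' = "\<lambda>_. borel"])
      (auto simp: iid_gaussian_def)
qed (use G in \<open>auto simp: iid_gaussian_def gaussian_vector_def\<close>)

text \<open>The choice \<open>a = sqrt (L / real n)\<close> gives \<open>n * a\<^sup>2 = L\<close>,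
  so \<open>L\<close> is the logarithm of the inverse failure probability.\<close>

lemma direction_upper_tail:
  assumes G: "iid_gaussian M X n S" and n: "1 \<le> n" and s: "u \<bullet> (S *v u) = s" "0 < s" and L: "0 < L"
  shows "\<P>(w in M. s * (1 + 2 * sqrt (L / real n) + 2 * (L / real n)) \<le> (\<Sum>m=1..n. (u \<bullet> X m w)\<^sup>2) / real n)
    \<le> exp (- L)"
proof -
  interpret prob_space M using G by (simp add: iid_gaussian_def)
  have "\<P>(w in M. real (card {1..n}) * s * (1 + 2 * sqrt (L / real n) + 2 * (sqrt (L / real n))\<^sup>2)
      \<le> (\<Sum>m=1..n. (u \<bullet> X m w)\<^sup>2)) \<le> exp (- real (card {1..n}) * (sqrt (L / real n))\<^sup>2)"
    using iid_gaussian_direction[OF G] s n L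
    by (intro chi_square_upper_tail) auto
  then show ?thesis
    using n L by (simp add: field_simps)
qed

lemma direction_lower_tail:
  assumes G: "iid_gaussian M X n S" and n: "1 \<le> n" and s: "u \<bullet> (S *v u) = s" "0 < s" and L: "0 < L"
  shows "\<P>(w in M. (\<Sum>m=1..n. (u \<bullet> X m w)\<^sup>2) / real n \<le> s * (1 - 2 * sqrt (L / real n)))
    \<le> exp (- L)"
proof -
  interpret prob_space M using G by (simp add: iid_gaussian_def)
  have "\<P>(w in M. (\<Sum>m=1..n. (u \<bullet> X m w)\<^sup>2) \<le> real (card {1..n}) * s * (1 - 2 * sqrt (L / real n)))
      \<le> exp (- real (card {1..n}) * (sqrt (L / real n))\<^sup>2)"
    using iid_gaussian_direction[OF G] s n L
    by (intro chi_square_lower_tail) auto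
  then show ?thesis
    using n L by (simp add: field_simps)
qed

text \<open>With \<open>\<sigma> = 1\<close> for one order of \<open>i, j\<close> and \<open>\<sigma> = - 1\<close> for the other, ordered pairs
  enumerate both vectors of each polarization identity exactly once.\<close>

definition polar :: "real \<Rightarrow> 'p \<Rightarrow> 'p \<Rightarrow> real ^ 'p" where
  "polar \<sigma> i j = (1 / sqrt 2) *\<^sub>R (axis i 1 + \<sigma> *\<^sub>R axis j 1)"

lemma inner_polar: "polar \<sigma> i j \<bullet> x = (x $ i + \<sigma> * x $ j) / sqrt 2"
  by (simp add: polar_def inner_add_left inner_axis')

lemma inner_polar_self:
  assumes "i \<noteq> j" "\<sigma>\<^sup>2 = 1"
  shows "polar \<sigma> i j \<bullet> polar \<sigma> i j = 1"
  using assms unfolding inner_polar by (simp add: polar_def axis_def power2_eq_square field_simps)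

text \<open>Expanding the square leaves a mean of diagonal entries that is the same for both signs
  of \<sigma>. Hence the values at 1 and -1 differ by twice the off-diagonal entry.\<close>

lemma sum_inner_polar:
  assumes "\<sigma>\<^sup>2 = 1"
  shows "(\<Sum>m=1..n. (polar \<sigma> i j \<bullet> x m)\<^sup>2) / real n =
    (empirical_cov n x $ i $ i + empirical_cov n x $ j $ j) / 2 + \<sigma> * empirical_cov n x $ i $ j"
proof -
  have "(polar \<sigma> i j \<bullet> x m)\<^sup>2 =
      (x m $ i * x m $ i + x m $ j * x m $ j) / 2 + \<sigma> * (x m $ i * x m $ j)" for m
  proof -
    have "(polar \<sigma> i j \<bullet> x m)\<^sup>2 =
        (x m $ i * x m $ i + 2 * \<sigma> * (x m $ i * x m $ j) + \<sigma>\<^sup>2 * (x m $ j * x m $ j)) / 2"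
      by (simp add: inner_polar power_divide power2_eq_square algebra_simps)
    then show ?thesis
      unfolding assms by (simp add: field_simps)
  qed
  then show ?thesis
    by (simp add: empirical_cov_nth sum.distrib sum_distrib_left[symmetric]
        sum_divide_distrib[symmetric] add_divide_distrib)
qed

section \<open>The two error probabilities of the test\<close>

lemma sdp_test_type_I:
  fixes X :: "nat \<Rightarrow> 'w \<Rightarrow> real ^ 'p"
  assumes G: "iid_gaussian M X n (mat 1)" and n: "1 \<le> n" and k: "1 \<le> k"
    and \<delta>: "0 < \<delta>" "\<delta> < 1" and \<tau>: "tau0_tilde n CARD('p) k \<delta> \<le> \<tau>"
  shows "\<P>(w in M. sdp_test k \<tau> (empirical_cov n (\<lambda>i. X i w)) = 1) \<le> \<delta>"
proof -
  interpret prob_space M using G by (simp add: iid_gaussian_def)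
  have [measurable]: "X m \<in> borel_measurable M" if "m \<in> {1..n}" for m
    by (rule iid_gaussian_direction(3)[OF G that])
  let ?p = "real CARD('p)"
  \<comment> \<open>Half of \<delta> goes to the \<open>p\<close> diagonal events, each at
    \<open>exp (- L1) = \<delta> / (2 * p)\<close>. The other half goes to both tails of at most
    \<open>p\<^sup>2\<close> ordered pairs, each tail at
    \<open>exp (- L2) = \<delta> / (4 * p\<^sup>2)\<close>.\<close>
  define L1 where "L1 = ln (2 * ?p / \<delta>)"
  define L2 where "L2 = ln (4 * ?p\<^sup>2 / \<delta>)"
  define d where "d = 1 + 2 * sqrt (L1 / real n) + 2 * (L1 / real n)"
  define c where "c = 2 * sqrt (L2 / real n) + 2 * (L2 / real n)"
  have p: "1 \<le> ?p" by (simp add: Suc_le_eq)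
  have "\<delta> < 2 * ?p"
    using \<delta> p by linarith
  then have L1: "0 < L1"
    using \<delta> unfolding L1_def by (intro ln_gt_zero) (simp add: less_divide_eq \<open>\<delta> < 2 * ?p\<close>)
  have "\<delta> < 4 * ?p\<^sup>2"
    using \<delta> p one_le_power[of ?p 2] by linarith
  then have L2: "0 < L2"
    using \<delta> by (simp add: L2_def)
  have e1: "exp (- L1) = \<delta> / (2 * ?p)" and e2: "exp (- L2) = \<delta> / (4 * ?p\<^sup>2)"
    using p \<delta> by (simp_all add: L1_def L2_def exp_minus)
  have c: "0 \<le> c" using L2 by (simp add: c_def)
  \<comment> \<open>The threshold is exactly the weak duality bound for diagonal entries up to
    \<open>d\<close> and off-diagonal entries up to \<open>c\<close>; the factor \<open>k\<close>
    enters the square root as \<open>k\<^sup>2\<close>.\<close>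
  have tau0: "tau0_tilde n CARD('p) k \<delta> = d + real k * c"
    by (simp add: tau0_tilde_def d_def c_def L1_def L2_def real_sqrt_mult real_sqrt_divide algebra_simps)
  \<comment> \<open>The index type carries no order, so an injection into the naturals decides which
    of \<open>(i, j)\<close> and \<open>(j, i)\<close> receives the sign 1.\<close>
  obtain g :: "'p \<Rightarrow> nat" where g: "inj g"
    using finite_imp_inj_to_nat_seg[of "UNIV :: 'p set"] by auto
  define \<sigma> :: "'p \<Rightarrow> 'p \<Rightarrow> real" where "\<sigma> i j = (if g i < g j then 1 else - 1)" for i j
  have \<sigma>2: "(\<sigma> i j)\<^sup>2 = 1" for i j by (simp add: \<sigma>_def)
  have \<sigma>_swap: "\<sigma> j i = - \<sigma> i j" if "i \<noteq> j" for i j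
    using that injD[OF g, of i j] by (auto simp: \<sigma>_def)
  define Q where "Q u w = (\<Sum>m=1..n. (u \<bullet> X m w)\<^sup>2) / real n" for u w
  have [measurable]: "Q u \<in> borel_measurable M" for u
    unfolding Q_def by measurable
  define P where "P = {q :: 'p \<times> 'p. fst q \<noteq> snd q}"
  define pol where "pol q = polar (\<sigma> (fst q) (snd q)) (fst q) (snd q)" for q
  define B1 where "B1 i = {w \<in> space M. d \<le> Q (axis i 1) w}" for i
  define B2 where "B2 q = {w \<in> space M. 1 + c \<le> Q (pol q) w}" for q
  define B3 where "B3 q = {w \<in> space M. Q (pol q) w \<le> 1 - c}" for q
  have [measurable]: "B1 i \<in> sets M" "B2 q \<in> sets M" "B3 q \<in> sets M" for i q
    unfolding B1_def B2_def B3_def by measurable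
  have pol1: "pol q \<bullet> (mat 1 *v pol q) = 1" if "q \<in> P" for q
    using that by (simp add: pol_def P_def inner_polar_self \<sigma>2)
  have mB1: "prob (B1 i) \<le> \<delta> / (2 * ?p)" for i
    using direction_upper_tail[OF G n _ _ L1, of "axis i 1" 1] unfolding e1
    by (simp add: B1_def d_def Q_def inner_axis')
  have mB2: "prob (B2 q) \<le> \<delta> / (4 * ?p\<^sup>2)" if "q \<in> P" for q
    using direction_upper_tail[OF G n pol1[OF that] _ L2] unfolding e2
    by (simp add: B2_def c_def Q_def add.assoc)
  have mB3: "prob (B3 q) \<le> \<delta> / (4 * ?p\<^sup>2)" if "q \<in> P" for q
  proof -
    \<comment> \<open>The lower tail has no linear term in \<open>L2 / n\<close>. Its deviation is
      at most \<open>c\<close>, so the event \<open>B3 q\<close> is contained in the one that the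
      tail bound controls.\<close>
    have "prob (B3 q) \<le> \<P>(w in M. Q (pol q) w \<le> 1 * (1 - 2 * sqrt (L2 / real n)))"
      using L2 by (intro finite_measure_mono) (auto simp: B3_def c_def intro: order_trans)
    also have "\<dots> \<le> \<delta> / (4 * ?p\<^sup>2)"
      using direction_lower_tail[OF G n pol1[OF that] _ L2] unfolding e2
      by (simp add: Q_def)
    finally show ?thesis .
  qed
  \<comment> \<open>The deterministic part: off the bad events, weak duality keeps
    \<open>SDP\<close> at or below \<open>\<tau>\<close>, so the test cannot reject.\<close>
  have sub: "{w \<in> space M. sdp_test k \<tau> (empirical_cov n (\<lambda>i. X i w)) = 1}
      \<subseteq> (\<Union>i\<in>UNIV. B1 i) \<union> (\<Union>q\<in>P. B2 q \<union> B3 q)"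
  proof (rule subsetI, rule ccontr)
    fix w
    assume w: "w \<in> {w \<in> space M. sdp_test k \<tau> (empirical_cov n (\<lambda>i. X i w)) = 1}"
      and nb: "w \<notin> (\<Union>i\<in>UNIV. B1 i) \<union> (\<Union>q\<in>P. B2 q \<union> B3 q)"
    define A where "A = empirical_cov n (\<lambda>i. X i w)"
    have A_sym: "A $ j $ i = A $ i $ j" for i j
      by (simp add: A_def empirical_cov_nth mult.commute)
    have Qpol: "Q (pol (i, j)) w = (A $ i $ i + A $ j $ j) / 2 + \<sigma> i j * A $ i $ j" for i j
      using sum_inner_polar[OF \<sigma>2, where x = "\<lambda>m. X m w"] by (simp add: Q_def pol_def A_def)
    have near: "\<bar>Q (pol (i, j)) w - 1\<bar> \<le> c" if "i \<noteq> j" for i j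
      using nb w that by (force simp: B2_def B3_def P_def)
    have "SDP k A \<le> d + real k * c"
    proof (rule SDP_le_diag_offdiag[OF k _ _ c])
      fix i
      have "A $ i $ i = Q (axis i 1) w"
        by (simp add: A_def Q_def empirical_cov_nth inner_axis' power2_eq_square)
      moreover have "w \<notin> B1 i" using nb by blast
      ultimately show "A $ i $ i \<le> d"
        using w by (simp add: B1_def)
    next
      fix i j :: 'p
      assume ij: "i \<noteq> j"
      \<comment> \<open>Both orders of the pair share the same mean of diagonal entries and carry
        opposite signs. The signed entry is half the difference of two quantities within
        \<open>c\<close> of 1.\<close>
      have "\<bar>\<sigma> i j * A $ i $ j\<bar> \<le> c"
        using near[OF ij] near[OF ij[symmetric]] unfolding Qpol \<sigma>_swap[OF ij] A_sym[of j i] mult_minus_left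
        unfolding abs_le_iff[where b = c] add_divide_distrib by (intro conjI; linarith)
      then show "\<bar>A $ i $ j\<bar> \<le> c"
        by (simp add: \<sigma>_def split: if_splits)
    qed
    moreover have "\<tau> < SDP k A"
      using w by (simp add: sdp_test_def A_def split: if_splits)
    ultimately show False
      using \<tau> tau0 by linarith
  qed
  have finP: "finite P" by (simp add: P_def)
  have "\<P>(w in M. sdp_test k \<tau> (empirical_cov n (\<lambda>i. X i w)) = 1)
      \<le> prob ((\<Union>i\<in>UNIV. B1 i) \<union> (\<Union>q\<in>P. B2 q \<union> B3 q))"
    using finP by (intro finite_measure_mono[OF sub]) measurable
  also have "\<dots> \<le> prob (\<Union>i\<in>UNIV. B1 i) + prob (\<Union>q\<in>P. B2 q \<union> B3 q)"
    using finP by (intro measure_Un_le) measurable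
  also have "\<dots> \<le> (\<Sum>i\<in>UNIV. prob (B1 i)) + (\<Sum>q\<in>P. prob (B2 q) + prob (B3 q))"
    using finP
    by (intro add_mono order_trans[OF measure_UNION_le] sum_mono measure_Un_le) auto
  also have "\<dots> \<le> (\<Sum>i\<in>(UNIV :: 'p set). \<delta> / (2 * ?p)) + (\<Sum>q\<in>P. \<delta> / (4 * ?p\<^sup>2) + \<delta> / (4 * ?p\<^sup>2))"
    by (intro add_mono sum_mono mB1 mB2 mB3)
  also have "\<dots> = \<delta> / 2 + real (card P) * (\<delta> / (2 * ?p\<^sup>2))"
    using p by (simp add: field_simps)
  \<comment> \<open>There are \<open>p * (p - 1)\<close> pairs in \<open>P\<close>; rounding up to
    \<open>p\<^sup>2\<close> matches the logarithm in \<open>tau0_tilde\<close>.\<close>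
  also have "\<dots> \<le> \<delta> / 2 + ?p\<^sup>2 * (\<delta> / (2 * ?p\<^sup>2))"
  proof (intro add_left_mono mult_right_mono)
    have "card P \<le> card (UNIV :: ('p \<times> 'p) set)" by (intro card_mono) auto
    then show "real (card P) \<le> ?p\<^sup>2"
      by (simp add: card_prod power2_eq_square flip: of_nat_mult)
  qed (use \<delta> in simp)
  also have "\<dots> = \<delta>" using p by simp
  finally show ?thesis .
qed

text \<open>The sample has variance \<open>1 + \<theta>\<close> in direction \<open>v\<close>, and
  \<open>tau1_tilde\<close> is the lower tail threshold for this variance at failure probability
  \<delta>. Since \<open>outer v v\<close> is feasible, accepting forces the empirical variance down
  to that threshold.\<close>

lemma sdp_test_type_II:
  assumes G: "iid_gaussian M X n (mat 1 + \<theta> *\<^sub>R outer v v)" and v: "v \<in> sparse_sphere k"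
    and n: "1 \<le> n" and \<delta>: "0 < \<delta>" "\<delta> < 1" and \<theta>: "0 < \<theta>" and \<tau>: "\<tau> \<le> tau1_tilde n \<delta> \<theta>"
  shows "\<P>(w in M. sdp_test k \<tau> (empirical_cov n (\<lambda>i. X i w)) = 0) \<le> \<delta>"
proof -
  interpret prob_space M using G by (simp add: iid_gaussian_def)
  have [measurable]: "X m \<in> borel_measurable M" if "m \<in> {1..n}" for m
    by (rule iid_gaussian_direction(3)[OF G that])
  define L where "L = ln (1 / \<delta>)"
  have L: "0 < L" "exp (- L) = \<delta>"
    using \<delta> by (simp_all add: L_def ln_div)
  have vv: "v \<bullet> v = 1" using v by (simp add: sparse_sphere_def dot_square_norm)
  have var: "v \<bullet> ((mat 1 + \<theta> *\<^sub>R outer v v) *v v) = 1 + \<theta>"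
    by (simp add: matrix_vector_mult_add_rdistrib scaleR_matrix_vector_assoc[symmetric]
        outer_mult_vector inner_add_right vv)
  have "\<P>(w in M. sdp_test k \<tau> (empirical_cov n (\<lambda>i. X i w)) = 0)
      \<le> \<P>(w in M. (\<Sum>m=1..n. (v \<bullet> X m w)\<^sup>2) / real n \<le> (1 + \<theta>) * (1 - 2 * sqrt (L / real n)))"
  proof (rule finite_measure_mono)
    show "{w \<in> space M. sdp_test k \<tau> (empirical_cov n (\<lambda>i. X i w)) = 0}
        \<subseteq> {w \<in> space M. (\<Sum>m=1..n. (v \<bullet> X m w)\<^sup>2) / real n \<le> (1 + \<theta>) * (1 - 2 * sqrt (L / real n))}"
    proof clarify
      fix w
      assume "sdp_test k \<tau> (empirical_cov n (\<lambda>i. X i w)) = 0"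
      then have "SDP k (empirical_cov n (\<lambda>i. X i w)) \<le> \<tau>"
        by (simp add: sdp_test_def split: if_splits)
      also note \<tau>
      also have "tau1_tilde n \<delta> \<theta> = (1 + \<theta>) * (1 - 2 * sqrt (L / real n))"
        by (simp add: tau1_tilde_def L_def algebra_simps)
      finally show "(\<Sum>m=1..n. (v \<bullet> X m w)\<^sup>2) / real n \<le> (1 + \<theta>) * (1 - 2 * sqrt (L / real n))"
        using SDP_upper[OF outer_feasible[OF v], of "empirical_cov n (\<lambda>i. X i w)"]
        by (simp add: trace_empirical_cov_outer)
    qed
  qed measurable
  also have "\<dots> \<le> \<delta>"
    using direction_lower_tail[OF G n var _ L(1)] \<theta> L(2) by simp
  finally show ?thesis .
qed

text \<open>The left end of the interval for \<tau> controls the type I error, the right end the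
  type II error. With \<open>s = sqrt (ln (1 / \<delta>) / n)\<close>, the interval is nonempty
  because \<open>theta_tilde \<le> 1\<close> gives
  \<open>theta_tilde * (1 - 2 * s) \<ge> theta_tilde - 2 * s\<close>, and the latter is
  \<open>tau0_tilde - 1 + 2 * s\<close>.\<close>

theorem theorem6p1:
  fixes n k :: nat and \<delta> \<theta> \<tau> :: real
  assumes "n \<ge> 1" and "k \<ge> 1" and "k \<le> CARD('p)"
    and "0 < \<delta>" and "\<delta> < 1"
    and "theta_tilde n CARD('p) k \<delta> \<le> 1"
    and "\<theta> > 0" and "\<theta> > theta_tilde n CARD('p) k \<delta>"
    and "\<tau> \<in> {tau0_tilde n CARD('p) k \<delta> .. tau1_tilde n \<delta> \<theta>}"
  shows "discriminates TYPE('w) n k \<theta> \<delta> (sdp_test k \<tau> :: real ^ 'p::finite ^ 'p \<Rightarrow> nat)"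
  unfolding discriminates_def
  using assms sdp_test_measurable[of k \<tau>] sdp_test_type_I[of _ _ n k \<delta> \<tau>]
    sdp_test_type_II[of _ _ n \<theta> _ k \<delta> \<tau>]
  by auto

end
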